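(* Let $D_1=\langle L_1,\oplus_1,\otimes_1,\bot_1,\top_1\rangle$ and $D_2=\langle L_2,\oplus_2,\otimes_2,\bot_2,\top_2\rangle$ be annotation domains. If $D_1$ is a lattice then, for every finite $A\subseteq L_1\times L_2$, $\overline A=\overline{\mathsf{Normalise}(A)}$.
   Context: An annotation domain is a tuple $D=\langle L,\oplus,\otimes,\bot,\top\rangle$ with $L$ a non-empty set, $\bot,\top\in L$, such that: $\oplus$ is idempotent, commutative, associative; $\otimes$ is commutative and associative; $\bot\oplus\lambda=\lambda$, $\top\otimes\lambda=\lambda$, $\bot\otimes\lambda=\bot$, $\top\oplus\lambda=\top$ for all $\lambda\in L$; and $\otimes$ distributes over $\oplus$. Its induced partial order is $\lambda\preceq\lambda'$ iff $\lambda\oplus\lambda'=\lambda'$; $\preceq_i$ is the order of $D_i$. Empty $\oplus_i$-sums are $\bot_i$, empty $\otimes_i$-products are $\top_i$. "$D_1$ is a lattice" means that $\otimes_1$ is the meet for $\preceq_1$: $z\preceq_1 x$ and $z\preceq_1 y$ iff $z\preceq_1 x\otimes_1 y$. Superscripts 1, 2 on big operators indicate the domain whose operation is used. For finite $A\subseteq L_1\times L_2$, $\overline A:L_1\to L_2$ is defined by $$\overline A(z)=\mathbf{lub}\Big\{\bigotimes_{\langle x,y\rangle\in J}{}^{\!\!\!2}\; y\ \Big|\ J\subseteq A,\ z\preceq_1\bigoplus_{\langle x,y\rangle\in J}{}^{\!\!\!1}\; x\Big\}$$ (least upper bound with respect to $\preceq_2$). $\mathsf{Saturate}(A)$ is the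 set of all pairs $$\Big\langle\bigoplus_{J\in X}{}^{\!1}\bigotimes_{\langle x,y\rangle\in J}{}^{\!\!\!1}x,\ \bigotimes_{J\in X}{}^{\!2}\bigoplus_{\langle x,y\rangle\in J}{}^{\!\!\!2}y\Big\rangle\quad\text{and}\quad\Big\langle\bigotimes_{J\in X}{}^{\!1}\bigoplus_{\langle x,y\rangle\in J}{}^{\!\!\!1}x,\ \bigoplus_{J\in X}{}^{\!2}\bigotimes_{\langle x,y\rangle\in J}{}^{\!\!\!2}y\Big\rangle$$ where $X$ ranges over all sets of subsets of $A$ ($X\subseteq 2^A$). $\mathsf{Reduce}(R)$, for finite $R\subseteq L_1\times L_2$, is obtained from $R$ by first removing, as long as possible, a pair $\langle x,y\rangle$ for which another pair $\langle x',y'\rangle\ne\langle x,y\rangle$ still in the set satisfies $x\preceq_1 x'$ and $y\preceq_2 y'$, and then removing all pairs $\langle x,y\rangle$ with $x=\bot_1$ or $y=\bot_2$. $\mathsf{Normalise}(A)=\mathsf{Reduce}(\mathsf{Saturate}(A))$. *)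

theory Defs
  imports "HOL-Algebra.Ring" "HOL-Algebra.Lattice" "HOL-Library.FuncSet"
begin

text \<open>
  Annotation domains are carried by the ring record of HOL-Algebra: the carrier is the set
  of annotations, and the bottom and top elements are \<open>\<zero>\<close> and \<open>\<one>\<close>. The locale \<open>semiring\<close>
  does not ask for additive inverses; it supplies the commutative monoid laws of \<open>\<oplus>\<close>,
  distributivity and \<open>\<zero> \<otimes> x = \<zero>\<close>.
\<close>

locale annotation_domain = semiring D + comm_monoid D for D (structure) +
  assumes add_idem: "x \<in> carrier D \<Longrightarrow> x \<oplus> x = x"
    and one_add: "x \<in> carrier D \<Longrightarrow> \<one> \<oplus> x = \<one>"

definition ann_order :: "('a, 'm) ring_scheme \<Rightarrow> 'a gorder" where
  "ann_order D = \<lparr>carrier = carrier D, eq = (=), le = (\<lambda>x y. x \<oplus>\<^bsub>D\<^esub> y = y)\<rparr>"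

abbreviation ann_le :: "('a, 'm) ring_scheme \<Rightarrow> 'a \<Rightarrow> 'a \<Rightarrow> bool" where
  "ann_le D x y \<equiv> x \<sqsubseteq>\<^bsub>ann_order D\<^esub> y"

abbreviation ann_lub :: "('a, 'm) ring_scheme \<Rightarrow> 'a set \<Rightarrow> 'a" where
  "ann_lub D S \<equiv> \<Squnion>\<^bsub>ann_order D\<^esub>S"

definition mult_is_meet :: "('a, 'm) ring_scheme \<Rightarrow> bool" where
  "mult_is_meet D \<longleftrightarrow>
    (\<forall>x\<in>carrier D. \<forall>y\<in>carrier D. \<forall>z\<in>carrier D.
      (ann_le D z x \<and> ann_le D z y) \<longleftrightarrow> ann_le D z (x \<otimes>\<^bsub>D\<^esub> y))"

text \<open>
  Sums and products over a set \<open>J\<close> of pairs are indexed by the pairs themselves, so equal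
  components of distinct pairs are counted separately; this matters because \<open>\<otimes>\<close> need not
  be idempotent.
\<close>

definition closure_fun ::
  "('a, 'm) ring_scheme \<Rightarrow> ('b, 'n) ring_scheme \<Rightarrow> ('a \<times> 'b) set \<Rightarrow> 'a \<Rightarrow> 'b" where
  "closure_fun D1 D2 A = (\<lambda>z\<in>carrier D1.
     ann_lub D2 {\<Otimes>\<^bsub>D2\<^esub>p\<in>J. snd p | J. J \<subseteq> A \<and> ann_le D1 z (\<Oplus>\<^bsub>D1\<^esub>p\<in>J. fst p)})"

definition saturate ::
  "('a, 'm) ring_scheme \<Rightarrow> ('b, 'n) ring_scheme \<Rightarrow> ('a \<times> 'b) set \<Rightarrow> ('a \<times> 'b) set" where
  "saturate D1 D2 A =
     {(\<Oplus>\<^bsub>D1\<^esub>J\<in>X. \<Otimes>\<^bsub>D1\<^esub>p\<in>J. fst p, \<Otimes>\<^bsub>D2\<^esub>J\<in>X. \<Oplus>\<^bsub>D2\<^esub>p\<in>J. snd p) | X. X \<subseteq> Pow A} \<union>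
     {(\<Otimes>\<^bsub>D1\<^esub>J\<in>X. \<Oplus>\<^bsub>D1\<^esub>p\<in>J. fst p, \<Oplus>\<^bsub>D2\<^esub>J\<in>X. \<Otimes>\<^bsub>D2\<^esub>p\<in>J. snd p) | X. X \<subseteq> Pow A}"

definition prune_step ::
  "('a, 'm) ring_scheme \<Rightarrow> ('b, 'n) ring_scheme \<Rightarrow> ('a \<times> 'b) set \<Rightarrow> ('a \<times> 'b) set \<Rightarrow> bool" where
  "prune_step D1 D2 R R' \<longleftrightarrow>
     (\<exists>p\<in>R. \<exists>q\<in>R. q \<noteq> p \<and> ann_le D1 (fst p) (fst q) \<and> ann_le D2 (snd p) (snd q) \<and> R' = R - {p})"

definition pruned_to ::
  "('a, 'm) ring_scheme \<Rightarrow> ('b, 'n) ring_scheme \<Rightarrow> ('a \<times> 'b) set \<Rightarrow> ('a \<times> 'b) set \<Rightarrow> bool" where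
  "pruned_to D1 D2 R S \<longleftrightarrow> (prune_step D1 D2)\<^sup>*\<^sup>* R S \<and> \<not> (\<exists>S'. prune_step D1 D2 S S')"

text \<open>
  The pruning process is nondeterministic. On finite sets of pairs from the carriers it ends
  in exactly one set, whatever the order of removals: see \<open>ex1_pruned_to\<close> below.
\<close>

definition reduce ::
  "('a, 'm) ring_scheme \<Rightarrow> ('b, 'n) ring_scheme \<Rightarrow> ('a \<times> 'b) set \<Rightarrow> ('a \<times> 'b) set" where
  "reduce D1 D2 R =
     (THE S. pruned_to D1 D2 R S) - {p. fst p = \<zero>\<^bsub>D1\<^esub> \<or> snd p = \<zero>\<^bsub>D2\<^esub>}"

definition normalise ::
  "('a, 'm) ring_scheme \<Rightarrow> ('b, 'n) ring_scheme \<Rightarrow> ('a \<times> 'b) set \<Rightarrow> ('a \<times> 'b) set" where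
  "normalise D1 D2 A = reduce D1 D2 (saturate D1 D2 A)"

lemma ann_le_iff: "ann_le D x y \<longleftrightarrow> x \<oplus>\<^bsub>D\<^esub> y = y"
  by (simp add: ann_order_def)

lemma (in annotation_domain) ann_le_trans:
  assumes "x \<in> carrier D" "y \<in> carrier D" "z \<in> carrier D" "ann_le D x y" "ann_le D y z"
  shows "ann_le D x z"
  using assms unfolding ann_le_iff by (metis a_assoc)

lemma (in annotation_domain) ann_le_antisym:
  assumes "x \<in> carrier D" "y \<in> carrier D" "ann_le D x y" "ann_le D y x"
  shows "x = y"
  using assms unfolding ann_le_iff by (metis a_comm)

lemma (in annotation_domain) partial_order_ann_order: "partial_order (ann_order D)"
proof -
  have sel: "carrier (ann_order D) = carrier D" "eq (ann_order D) = (=)"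
    by (simp_all add: ann_order_def)
  show ?thesis
  proof (unfold_locales, unfold sel)
    fix x y z
    assume "ann_le D x y" "ann_le D y z" "x \<in> carrier D" "y \<in> carrier D" "z \<in> carrier D"
    then show "ann_le D x z" by (metis ann_le_trans)
  next
    fix x y
    assume "ann_le D x y" "ann_le D y x" "x \<in> carrier D" "y \<in> carrier D"
    then show "x = y" by (metis ann_le_antisym)
  next
    fix x
    assume "x \<in> carrier D"
    then show "ann_le D x x" by (simp add: ann_le_iff add_idem)
  qed simp_all
qed

lemma ex1_pruned_to:
  assumes D1: "annotation_domain D1" and D2: "annotation_domain D2"
    and fin: "finite R" and R: "R \<subseteq> carrier D1 \<times> carrier D2"
  shows "\<exists>!S. pruned_to D1 D2 R S"
proof -
  interpret D1: annotation_domain D1 by fact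
  interpret D2: annotation_domain D2 by fact
  define below where
    "below p q \<longleftrightarrow> ann_le D1 (fst p) (fst q) \<and> ann_le D2 (snd p) (snd q)" for p q
  define M where "M T = {p \<in> T. \<forall>q\<in>T. below p q \<longrightarrow> q = p}" for T
  let ?C = "carrier D1 \<times> carrier D2"
  have step_iff: "prune_step D1 D2 T T' \<longleftrightarrow>
      (\<exists>p\<in>T. \<exists>q\<in>T. q \<noteq> p \<and> below p q \<and> T' = T - {p})" for T T'
    by (simp add: prune_step_def below_def)
  have trans: "below p r" if "below p q" "below q r" "p \<in> ?C" "q \<in> ?C" "r \<in> ?C" for p q r
    using that D1.ann_le_trans[of "fst p" "fst q" "fst r"] D2.ann_le_trans[of "snd p" "snd q" "snd r"]
    unfolding below_def by (auto simp: mem_Times_iff)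
  have antisym: "p = q" if "below p q" "below q p" "p \<in> ?C" "q \<in> ?C" for p q
    using that D1.ann_le_antisym[of "fst p" "fst q"] D2.ann_le_antisym[of "snd p" "snd q"]
    unfolding below_def by (auto simp: mem_Times_iff prod_eq_iff)
  have M_step: "M T' = M T" if step: "prune_step D1 D2 T T'" and T: "T \<subseteq> ?C" for T T'
  proof -
    obtain p q where pq: "p \<in> T" "q \<in> T" "q \<noteq> p" "below p q" "T' = T - {p}"
      using step unfolding step_iff by blast
    have "r \<in> M T" if r: "r \<in> M T'" for r
    proof -
      have rT: "r \<in> T" "r \<noteq> p" and max: "\<And>s. s \<in> T \<Longrightarrow> s \<noteq> p \<Longrightarrow> below r s \<Longrightarrow> s = r"
        using r pq(5) unfolding M_def by auto
      have "\<not> below r p"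
      proof
        assume rp: "below r p"
        then have "below r q" using trans[OF rp pq(4)] rT pq T by blast
        then have "q = r" using max pq by blast
        then show False using antisym[OF rp] rT pq T by blast
      qed
      then show ?thesis using max rT unfolding M_def by blast
    qed
    moreover have "r \<in> M T'" if "r \<in> M T" for r
      using that pq unfolding M_def by auto
    ultimately show ?thesis by blast
  qed
  have M_steps: "T \<subseteq> R \<and> M T = M R" if "(prune_step D1 D2)\<^sup>*\<^sup>* R T" for T
    using that
  proof (induction rule: rtranclp_induct)
    case (step T T')
    then have "T' \<subseteq> T" unfolding step_iff by blast
    with step M_step[of T T'] R show ?case by blast
  qed simp
  have unique: "S = M R" if "pruned_to D1 D2 R S" for S
  proof -
    have "\<not> (\<exists>p\<in>S. \<exists>q\<in>S. q \<noteq> p \<and> below p q)"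
      using that unfolding pruned_to_def step_iff by blast
    then have "M S = S" unfolding M_def by blast
    then show ?thesis using M_steps that unfolding pruned_to_def by blast
  qed
  have "\<exists>S. pruned_to D1 D2 T S" if "finite T" for T
    using that
  proof (induction rule: finite_psubset_induct)
    case (psubset T)
    show ?case
    proof (cases "\<exists>T'. prune_step D1 D2 T T'")
      case True
      then obtain T' where T': "prune_step D1 D2 T T'" by blast
      then have "T' \<subset> T" unfolding step_iff by blast
      then obtain S where "pruned_to D1 D2 T' S" using psubset.IH by blast
      with T' show ?thesis
        unfolding pruned_to_def by (meson converse_rtranclp_into_rtranclp)
    qed (auto simp: pruned_to_def)
  qed
  with fin unique show ?thesis by blast
qed

end

theory Submission
  imports Defs
begin

text \<open>
  Write \<open>cl A\<close> for the function \<open>closure_fun D1 D2 A\<close>. By distributivity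
  \<open>cl A u \<otimes> cl A v \<preceq> cl A (u \<oplus> v)\<close>, and \<open>cl A\<close> is antitone. Hence \<open>cl B \<preceq> cl A\<close> pointwise as
  soon as \<open>y \<preceq> cl A x\<close> for every pair \<open>(x, y)\<close> in \<open>B\<close>. Each pair added by saturation and each
  pair removed by reduction meets this criterion with respect to the remaining set.
\<close>

section \<open>Order and finite sums and products in a single annotation domain\<close>

context annotation_domain
begin

lemma le_refl: "x \<in> carrier D \<Longrightarrow> ann_le D x x"
  by (simp add: ann_le_iff add_idem)

lemma zero_le: "x \<in> carrier D \<Longrightarrow> ann_le D \<zero> x"
  by (simp add: ann_le_iff)

lemma le_one: "x \<in> carrier D \<Longrightarrow> ann_le D x \<one>"
  by (metis ann_le_iff one_add a_comm one_closed)

lemma le_add1: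
  assumes "x \<in> carrier D" "y \<in> carrier D"
  shows "ann_le D x (x \<oplus> y)"
  using assms unfolding ann_le_iff by (metis a_assoc add_idem)

lemma add_least:
  assumes "x \<in> carrier D" "y \<in> carrier D" "z \<in> carrier D" "ann_le D x z" "ann_le D y z"
  shows "ann_le D (x \<oplus> y) z"
  using assms unfolding ann_le_iff by (metis a_assoc)

lemma mult_left_mono:
  assumes "x \<in> carrier D" "y \<in> carrier D" "c \<in> carrier D" "ann_le D x y"
  shows "ann_le D (c \<otimes> x) (c \<otimes> y)"
  using assms unfolding ann_le_iff by (metis r_distr)

lemma mult_mono:
  assumes "x \<in> carrier D" "y \<in> carrier D" "x' \<in> carrier D" "y' \<in> carrier D"
    and "ann_le D x x'" "ann_le D y y'"
  shows "ann_le D (x \<otimes> y) (x' \<otimes> y')"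
proof (rule ann_le_trans)
  show "ann_le D (x \<otimes> y) (x \<otimes> y')" using assms by (simp add: mult_left_mono)
  show "ann_le D (x \<otimes> y') (x' \<otimes> y')"
    using assms mult_left_mono[of x x' y'] by (simp add: m_comm)
qed (use assms in auto)

lemma mult_le1:
  assumes "x \<in> carrier D" "y \<in> carrier D"
  shows "ann_le D (x \<otimes> y) x"
  using mult_left_mono[of y \<one> x] assms le_one by simp

lemma finsum_upper:
  assumes "finite I" "f \<in> I \<rightarrow> carrier D" "i \<in> I"
  shows "ann_le D (f i) (\<Oplus>j\<in>I. f j)"
proof -
  have "(\<Oplus>j\<in>insert i (I - {i}). f j) = f i \<oplus> (\<Oplus>j\<in>I - {i}. f j)"
    using assms by (intro finsum_insert) auto
  moreover have "f i \<in> carrier D" "(\<Oplus>j\<in>I - {i}. f j) \<in> carrier D"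
    using assms by (auto intro!: finsum_closed)
  ultimately show ?thesis using le_add1 assms(3) by (simp add: insert_absorb)
qed

lemma finsum_least:
  assumes "finite I" "f \<in> I \<rightarrow> carrier D" "c \<in> carrier D" "\<And>i. i \<in> I \<Longrightarrow> ann_le D (f i) c"
  shows "ann_le D (\<Oplus>i\<in>I. f i) c"
  using assms
proof (induction I)
  case (insert i I)
  then have "f \<in> I \<rightarrow> carrier D" "f i \<in> carrier D" by auto
  with insert show ?case by (simp add: add_least)
qed (simp add: zero_le)

lemma finsum_subset_mono:
  assumes "finite I" "f \<in> I \<rightarrow> carrier D" "J \<subseteq> I"
  shows "ann_le D (\<Oplus>i\<in>J. f i) (\<Oplus>i\<in>I. f i)"
proof (rule finsum_least)
  show "finite J" using assms finite_subset by blast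
  show "f \<in> J \<rightarrow> carrier D" using assms by auto
  show "ann_le D (f i) (\<Oplus>i\<in>I. f i)" if "i \<in> J" for i
    using that assms by (intro finsum_upper) auto
qed (use assms finsum_closed in auto)

text \<open>Every factor lies below \<open>\<one>\<close>, so by \<open>mult_le1\<close> discarding
  factors can only enlarge a product.\<close>

lemma finprod_subset_antimono:
  assumes "finite I" "f \<in> I \<rightarrow> carrier D" "J \<subseteq> I"
  shows "ann_le D (\<Otimes>i\<in>I. f i) (\<Otimes>i\<in>J. f i)"
proof -
  have "(\<Otimes>i\<in>J \<union> (I - J). f i) = (\<Otimes>i\<in>J. f i) \<otimes> (\<Otimes>i\<in>I - J. f i)"
    using assms by (intro finprod_Un_disjoint) (auto intro: finite_subset)
  moreover have "(\<Otimes>i\<in>J. f i) \<in> carrier D" "(\<Otimes>i\<in>I - J. f i) \<in> carrier D"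
    using assms by (auto intro!: finprod_closed)
  moreover have "J \<union> (I - J) = I" using assms by blast
  ultimately show ?thesis using mult_le1 by simp
qed

lemma finprod_lower:
  assumes "finite I" "f \<in> I \<rightarrow> carrier D" "i \<in> I"
  shows "ann_le D (\<Otimes>j\<in>I. f j) (f i)"
proof -
  have "f i \<in> carrier D" using assms by blast
  then show ?thesis using finprod_subset_antimono[of I f "{i}"] assms by simp
qed

text \<open>Indices in the overlap are counted twice on the left and once on the right. As
  \<open>\<otimes>\<close> need not be idempotent, only an inequality is available: the second
  product is first enlarged by dropping the overlap, and then the union is disjoint.\<close>

lemma finprod_mult_le_Un:
  assumes "finite I" "finite J" "f \<in> I \<union> J \<rightarrow> carrier D"
  shows "ann_le D ((\<Otimes>i\<in>I. f i) \<otimes> (\<Otimes>i\<in>J. f i)) (\<Otimes>i\<in>I \<union> J. f i)"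
proof -
  have closed: "(\<Otimes>i\<in>K. f i) \<in> carrier D" if "K \<subseteq> I \<union> J" for K
    using assms that by (intro finprod_closed) auto
  have "(\<Otimes>i\<in>I \<union> (J - I). f i) = (\<Otimes>i\<in>I. f i) \<otimes> (\<Otimes>i\<in>J - I. f i)"
    using assms by (intro finprod_Un_disjoint) auto
  moreover have "ann_le D (\<Otimes>i\<in>J. f i) (\<Otimes>i\<in>J - I. f i)"
    using assms by (intro finprod_subset_antimono) auto
  ultimately show ?thesis using closed mult_left_mono by (simp add: le_supI2)
qed

text \<open>Idempotence makes a finite sum the join of its summands. Rewriting the least upper bound
  as a sum is what later lets distributivity act on the closure.\<close>

lemma ann_lub_eq_finsum:
  assumes "finite S" "S \<subseteq> carrier D"
  shows "ann_lub D S = (\<Oplus>s\<in>S. s)"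
proof -
  interpret O: partial_order "ann_order D" by (rule partial_order_ann_order)
  have [simp]: "carrier (ann_order D) = carrier D" by (simp add: ann_order_def)
  have "least (ann_order D) (\<Oplus>s\<in>S. s) (Upper (ann_order D) S)"
  proof (rule least_UpperI)
    show "ann_le D s (\<Oplus>s\<in>S. s)" if "s \<in> S" for s
      using that assms by (intro finsum_upper) auto
    show "ann_le D (\<Oplus>s\<in>S. s) c" if "c \<in> Upper (ann_order D) S" for c
      using that assms by (intro finsum_least) (auto simp: Upper_def)
  qed (use assms in \<open>auto intro!: finsum_closed\<close>)
  \<comment> \<open>\<open>sup_def\<close> picks some least upper bound by choice; uniqueness of
    least elements in a partial order identifies the pick with the sum.\<close>
  then show ?thesis
    unfolding sup_def by (metis O.least_unique someI_ex)
qed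

end

section \<open>The closure of a finite relation between two domains\<close>

locale annotation_domain_pair = D1: annotation_domain D1 + D2: annotation_domain D2
  for D1 :: "('a, 'm) ring_scheme" and D2 :: "('b, 'n) ring_scheme"
begin

abbreviation fin_rel :: "('a \<times> 'b) set \<Rightarrow> bool" where
  "fin_rel A \<equiv> finite A \<and> A \<subseteq> carrier D1 \<times> carrier D2"

abbreviation join_fst :: "('a \<times> 'b) set \<Rightarrow> 'a" where
  "join_fst J \<equiv> \<Oplus>\<^bsub>D1\<^esub>p\<in>J. fst p"

abbreviation prod_snd :: "('a \<times> 'b) set \<Rightarrow> 'b" where
  "prod_snd J \<equiv> \<Otimes>\<^bsub>D2\<^esub>p\<in>J. snd p"

abbreviation cl :: "('a \<times> 'b) set \<Rightarrow> 'a \<Rightarrow> 'b" where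
  "cl \<equiv> closure_fun D1 D2"

definition cl_values :: "('a \<times> 'b) set \<Rightarrow> 'a \<Rightarrow> 'b set" where
  "cl_values A z = prod_snd ` {J. J \<subseteq> A \<and> ann_le D1 z (join_fst J)}"

text \<open>The hypothesis of the comparison criterion \<open>cl_mono_derives\<close>: the pairs of
  \<open>B\<close> carry no information beyond that of \<open>A\<close>.\<close>

definition derives :: "('a \<times> 'b) set \<Rightarrow> ('a \<times> 'b) set \<Rightarrow> bool" where
  "derives A B \<longleftrightarrow> (\<forall>p\<in>B. ann_le D2 (snd p) (cl A (fst p)))"

lemma fin_rel_subset: "fin_rel A \<Longrightarrow> B \<subseteq> A \<Longrightarrow> fin_rel B"
  using finite_subset by blast

lemma components_closed:
  assumes "A \<subseteq> carrier D1 \<times> carrier D2"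
  shows "fst \<in> A \<rightarrow> carrier D1" "snd \<in> A \<rightarrow> carrier D2"
  using assms by auto

lemma sums_closed:
  assumes "A \<subseteq> carrier D1 \<times> carrier D2"
  shows "join_fst A \<in> carrier D1" "(\<Otimes>\<^bsub>D1\<^esub>p\<in>A. fst p) \<in> carrier D1"
    "prod_snd A \<in> carrier D2" "(\<Oplus>\<^bsub>D2\<^esub>p\<in>A. snd p) \<in> carrier D2"
  using components_closed[OF assms]
  by (simp_all add: D1.finsum_closed D1.finprod_closed D2.finsum_closed D2.finprod_closed)

lemma cl_values_fin:
  assumes "fin_rel A"
  shows "finite (cl_values A z)" "cl_values A z \<subseteq> carrier D2"
proof -
  have "{J. J \<subseteq> A \<and> ann_le D1 z (join_fst J)} \<subseteq> Pow A" by blast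
  then show "finite (cl_values A z)"
    unfolding cl_values_def using assms by (meson finite_Pow_iff finite_imageI finite_subset)
  show "cl_values A z \<subseteq> carrier D2"
    unfolding cl_values_def using assms sums_closed(3) by blast
qed

lemma cl_eq:
  assumes "fin_rel A" "z \<in> carrier D1"
  shows "cl A z = (\<Oplus>\<^bsub>D2\<^esub>s\<in>cl_values A z. s)"
proof -
  have "cl A z = ann_lub D2 (cl_values A z)"
    using assms by (simp add: closure_fun_def cl_values_def setcompr_eq_image)
  then show ?thesis using D2.ann_lub_eq_finsum cl_values_fin[OF assms(1)] by simp
qed

lemma cl_closed:
  assumes "fin_rel A" "z \<in> carrier D1"
  shows "cl A z \<in> carrier D2"
  unfolding cl_eq[OF assms] using cl_values_fin[OF assms(1)]
  by (intro D2.finsum_closed) auto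

lemma cl_upper:
  assumes "fin_rel A" "z \<in> carrier D1" "J \<subseteq> A" "ann_le D1 z (join_fst J)"
  shows "ann_le D2 (prod_snd J) (cl A z)"
proof -
  have "prod_snd J \<in> cl_values A z" using assms unfolding cl_values_def by blast
  then show ?thesis
    unfolding cl_eq[OF assms(1,2)] using cl_values_fin[OF assms(1)]
    by (intro D2.finsum_upper) auto
qed

lemma cl_least:
  assumes "fin_rel A" "z \<in> carrier D1" "c \<in> carrier D2"
    and "\<And>J. J \<subseteq> A \<Longrightarrow> ann_le D1 z (join_fst J) \<Longrightarrow> ann_le D2 (prod_snd J) c"
  shows "ann_le D2 (cl A z) c"
  unfolding cl_eq[OF assms(1,2)]
proof (rule D2.finsum_least)
  show "ann_le D2 s c" if "s \<in> cl_values A z" for s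
    using that assms(4) unfolding cl_values_def by blast
qed (use cl_values_fin[OF assms(1)] assms(3) in auto)

text \<open>A larger argument admits fewer sets \<open>J\<close>, by transitivity of the
  order.\<close>

lemma cl_antimono:
  assumes "fin_rel A" "z \<in> carrier D1" "z' \<in> carrier D1" "ann_le D1 z z'"
  shows "ann_le D2 (cl A z') (cl A z)"
proof (rule cl_least)
  fix J assume J: "J \<subseteq> A" "ann_le D1 z' (join_fst J)"
  then have "J \<subseteq> carrier D1 \<times> carrier D2" using fin_rel_subset[OF assms(1)] by simp
  then have "ann_le D1 z (join_fst J)"
    using D1.ann_le_trans[OF assms(2,3) sums_closed(1) assms(4) J(2)] by simp
  then show "ann_le D2 (prod_snd J) (cl A z)" by (rule cl_upper[OF assms(1,2) J(1)])
qed (use assms cl_closed in simp_all)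

lemma le_cl_antimono:
  assumes "fin_rel A" "z \<in> carrier D1" "z' \<in> carrier D1" "ann_le D1 z z'"
    and "y \<in> carrier D2" "ann_le D2 y (cl A z')"
  shows "ann_le D2 y (cl A z)"
  using D2.ann_le_trans[OF assms(5) cl_closed[OF assms(1,3)] cl_closed[OF assms(1,2)] assms(6)
      cl_antimono[OF assms(1-4)]] .

lemma derives_subset:
  assumes "fin_rel A" "B \<subseteq> A"
  shows "derives A B"
  unfolding derives_def
proof
  fix p assume "p \<in> B"
  then have p: "p \<in> A" "fst p \<in> carrier D1" "snd p \<in> carrier D2" using assms by auto
  \<comment> \<open>The singleton \<open>{p}\<close> is admissible at \<open>fst p\<close>, and its
    product is \<open>snd p\<close>.\<close>
  then show "ann_le D2 (snd p) (cl A (fst p))"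
    using cl_upper[of A "fst p" "{p}"] assms D1.le_refl by simp
qed

section \<open>Closures of sums and the comparison criterion\<close>

lemma cl_zero:
  assumes "fin_rel A" "y \<in> carrier D2"
  shows "ann_le D2 y (cl A \<zero>\<^bsub>D1\<^esub>)"
proof -
  \<comment> \<open>The empty set is admissible at zero: its sum is zero, and its empty product is
    the top element.\<close>
  have "ann_le D2 \<one>\<^bsub>D2\<^esub> (cl A \<zero>\<^bsub>D1\<^esub>)"
    using cl_upper[of A "\<zero>\<^bsub>D1\<^esub>" "{}"] assms D1.le_refl by simp
  then show ?thesis
    using assms cl_closed[of A "\<zero>\<^bsub>D1\<^esub>"] D2.le_one D2.ann_le_trans[of y "\<one>\<^bsub>D2\<^esub>"] by simp
qed

text \<open>If \<open>J\<close> is admissible at \<open>u\<close> and \<open>K\<close> at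
  \<open>v\<close>, then \<open>J \<union> K\<close> is admissible at the sum. This bounds the
  products of individual values, and distributivity carries the bound over to the product of the two
  joins.\<close>

lemma cl_mult:
  assumes A: "fin_rel A" and u: "u \<in> carrier D1" and v: "v \<in> carrier D1"
  shows "ann_le D2 (cl A u \<otimes>\<^bsub>D2\<^esub> cl A v) (cl A (u \<oplus>\<^bsub>D1\<^esub> v))"
proof -
  let ?w = "cl A (u \<oplus>\<^bsub>D1\<^esub> v)"
  have w: "u \<oplus>\<^bsub>D1\<^esub> v \<in> carrier D1" "?w \<in> carrier D2" using assms cl_closed by auto
  have *: "ann_le D2 (prod_snd J \<otimes>\<^bsub>D2\<^esub> prod_snd K) ?w"
    if J: "J \<subseteq> A" "ann_le D1 u (join_fst J)" and K: "K \<subseteq> A" "ann_le D1 v (join_fst K)" for J K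
  proof -
    have JK: "J \<union> K \<subseteq> A" and fin: "fin_rel J" "fin_rel K" "fin_rel (J \<union> K)"
      using J K fin_rel_subset[OF A] by simp_all
    \<comment> \<open>Four facts for each set: 1-4 concern \<open>J\<close>, 5-8 concern
      \<open>K\<close>, and 9-12 concern the union.\<close>
    note closed = sums_closed[OF conjunct2[OF fin(1)]] sums_closed[OF conjunct2[OF fin(2)]]
      sums_closed[OF conjunct2[OF fin(3)]]
    have mono: "ann_le D1 (join_fst L) (join_fst (J \<union> K))" if "L \<subseteq> J \<union> K" for L
      using fin(3) components_closed(1) that by (intro D1.finsum_subset_mono) simp_all
    have "ann_le D1 u (join_fst (J \<union> K))"
      using D1.ann_le_trans[OF u closed(1,9) J(2) mono] by simp
    moreover have "ann_le D1 v (join_fst (J \<union> K))"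
      using D1.ann_le_trans[OF v closed(5,9) K(2) mono] by simp
    ultimately have "ann_le D1 (u \<oplus>\<^bsub>D1\<^esub> v) (join_fst (J \<union> K))"
      using D1.add_least u v closed by simp
    then have "ann_le D2 (prod_snd (J \<union> K)) ?w" by (rule cl_upper[OF A w(1) JK])
    moreover have "ann_le D2 (prod_snd J \<otimes>\<^bsub>D2\<^esub> prod_snd K) (prod_snd (J \<union> K))"
      using fin components_closed(2) by (intro D2.finprod_mult_le_Un) simp_all
    ultimately show ?thesis
      using D2.ann_le_trans[OF D2.m_closed[OF closed(3,7)] closed(11) w(2)] by simp
  qed
  note values_u = cl_values_fin[OF A, of u] and values_v = cl_values_fin[OF A, of v]
  have id: "(\<lambda>s. s) \<in> S \<rightarrow> carrier D2" if "S \<subseteq> carrier D2" for S using that by auto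
  \<comment> \<open>The double sum is expanded one factor at a time: first over the values at
    \<open>v\<close> with \<open>s\<close> fixed, afterwards over \<open>s\<close>.\<close>
  have "ann_le D2 (s \<otimes>\<^bsub>D2\<^esub> cl A v) ?w" if s: "s \<in> cl_values A u" for s
  proof -
    have sc: "s \<in> carrier D2" using s values_u by blast
    have "s \<otimes>\<^bsub>D2\<^esub> cl A v = (\<Oplus>\<^bsub>D2\<^esub>t\<in>cl_values A v. s \<otimes>\<^bsub>D2\<^esub> t)"
      unfolding cl_eq[OF A v] using values_v sc id by (simp add: D2.finsum_rdistr)
    moreover have "ann_le D2 (\<Oplus>\<^bsub>D2\<^esub>t\<in>cl_values A v. s \<otimes>\<^bsub>D2\<^esub> t) ?w"
    proof (rule D2.finsum_least)
      show "ann_le D2 (s \<otimes>\<^bsub>D2\<^esub> t) ?w" if "t \<in> cl_values A v" for t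
        using s that * unfolding cl_values_def by auto
    qed (use values_v sc w in auto)
    ultimately show ?thesis by simp
  qed
  moreover have "cl A u \<otimes>\<^bsub>D2\<^esub> cl A v = (\<Oplus>\<^bsub>D2\<^esub>s\<in>cl_values A u. s \<otimes>\<^bsub>D2\<^esub> cl A v)"
    unfolding cl_eq[OF A u] using values_u cl_closed[OF A v] id by (simp add: D2.finsum_ldistr)
  moreover have "ann_le D2 (\<Oplus>\<^bsub>D2\<^esub>s\<in>cl_values A u. s \<otimes>\<^bsub>D2\<^esub> cl A v) ?w"
    if "\<And>s. s \<in> cl_values A u \<Longrightarrow> ann_le D2 (s \<otimes>\<^bsub>D2\<^esub> cl A v) ?w"
    using values_u cl_closed[OF A v] w that by (intro D2.finsum_least) auto
  ultimately show ?thesis by simp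
qed

text \<open>Iteration of \<open>cl_mult\<close>, starting from \<open>cl_zero\<close> for the empty
  index set. The index type is arbitrary because the lemma is applied both to sets of pairs and to
  sets of such sets.\<close>

lemma finprod_le_cl_finsum:
  assumes "fin_rel A" "finite I" "u \<in> I \<rightarrow> carrier D1" "v \<in> I \<rightarrow> carrier D2"
    and "\<And>i. i \<in> I \<Longrightarrow> ann_le D2 (v i) (cl A (u i))"
  shows "ann_le D2 (\<Otimes>\<^bsub>D2\<^esub>i\<in>I. v i) (cl A (\<Oplus>\<^bsub>D1\<^esub>i\<in>I. u i))"
  using assms(2-)
proof (induction I)
  case empty
  show ?case using cl_zero assms(1) by simp
next
  case (insert i I)
  then have f: "u i \<in> carrier D1" "v i \<in> carrier D2" "u \<in> I \<rightarrow> carrier D1" "v \<in> I \<rightarrow> carrier D2"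
    by auto
  let ?s = "\<Oplus>\<^bsub>D1\<^esub>i\<in>I. u i" and ?p = "\<Otimes>\<^bsub>D2\<^esub>i\<in>I. v i"
  have sp: "?s \<in> carrier D1" "?p \<in> carrier D2"
    using f D1.finsum_closed D2.finprod_closed by auto
  have "ann_le D2 (v i \<otimes>\<^bsub>D2\<^esub> ?p) (cl A (u i) \<otimes>\<^bsub>D2\<^esub> cl A ?s)"
    using insert f sp cl_closed[OF assms(1)] by (intro D2.mult_mono) auto
  then have "ann_le D2 (v i \<otimes>\<^bsub>D2\<^esub> ?p) (cl A (u i \<oplus>\<^bsub>D1\<^esub> ?s))"
    using cl_mult[OF assms(1) f(1) sp(1)] f sp cl_closed[OF assms(1)]
    by (meson D1.a_closed D2.ann_le_trans D2.m_closed)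
  then show ?case using insert(1,2) f by simp
qed

text \<open>For \<open>J\<close> admissible in \<open>B\<close> at \<open>z\<close>, the product
  over \<open>J\<close> lies below \<open>cl A (join_fst J)\<close> by
  \<open>finprod_le_cl_finsum\<close>, and this lies below \<open>cl A z\<close> by
  antitonicity.\<close>

lemma cl_mono_derives:
  assumes A: "fin_rel A" and B: "fin_rel B" and z: "z \<in> carrier D1" and der: "derives A B"
  shows "ann_le D2 (cl B z) (cl A z)"
proof (rule cl_least[OF B z cl_closed[OF A z]])
  fix J assume J: "J \<subseteq> B" "ann_le D1 z (join_fst J)"
  have fin: "fin_rel J" using fin_rel_subset[OF B J(1)] .
  then have "ann_le D2 (prod_snd J) (cl A (join_fst J))"
    using J(1) der components_closed
    by (intro finprod_le_cl_finsum[OF A]) (auto simp: derives_def)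
  then show "ann_le D2 (prod_snd J) (cl A z)"
    using le_cl_antimono[OF A z _ J(2)] fin sums_closed by simp
qed

lemma cl_eqI:
  assumes "fin_rel A" "fin_rel B" "derives A B" "derives B A"
  shows "cl A = cl B"
proof
  fix z
  show "cl A z = cl B z"
  proof (cases "z \<in> carrier D1")
    case True
    then show ?thesis
      using assms by (intro D2.ann_le_antisym cl_mono_derives cl_closed) simp_all
  \<comment> \<open>Outside the carrier both functions are \<open>undefined\<close>, by the
    restriction in \<open>closure_fun\<close>.\<close>
  qed (simp add: closure_fun_def)
qed

section \<open>Saturation preserves the closure\<close>

lemma saturate_fin:
  assumes A: "fin_rel A"
  shows "fin_rel (saturate D1 D2 A)"
proof
  have "finite (Pow (Pow A))" using A by simp
  then show "finite (saturate D1 D2 A)"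
    \<comment> \<open>Unfolding only the outer \<open>Pow\<close> gives the finite index set the
      form in which it occurs in \<open>saturate_def\<close>.\<close>
    unfolding saturate_def Pow_def[of "Pow A"] by (auto simp: Setcompr_eq_image)
  have "J \<subseteq> carrier D1 \<times> carrier D2" if "X \<subseteq> Pow A" "J \<in> X" for X J
    using that A by blast
  then show "saturate D1 D2 A \<subseteq> carrier D1 \<times> carrier D2"
    unfolding saturate_def
    by (auto intro!: D1.finsum_closed D1.finprod_closed D2.finsum_closed D2.finprod_closed
        sums_closed)
qed

lemma subset_saturate:
  assumes A: "fin_rel A"
  shows "A \<subseteq> saturate D1 D2 A"
proof
  fix p assume p: "p \<in> A"
  \<comment> \<open>With one inner set containing one pair, all four operations collapse to the
    components of \<open>p\<close>.\<close>
  let ?X = "{{p}}"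
  have "fst p \<in> carrier D1" "snd p \<in> carrier D2" using p A by auto
  then have "p = (\<Oplus>\<^bsub>D1\<^esub>J\<in>?X. \<Otimes>\<^bsub>D1\<^esub>p\<in>J. fst p, \<Otimes>\<^bsub>D2\<^esub>J\<in>?X. \<Oplus>\<^bsub>D2\<^esub>p\<in>J. snd p)"
    by simp
  moreover have "?X \<subseteq> Pow A" using p by simp
  ultimately show "p \<in> saturate D1 D2 A" unfolding saturate_def by blast
qed

lemma derives_saturate:
  assumes A: "fin_rel A"
  shows "derives A (saturate D1 D2 A)"
  unfolding derives_def
proof
  fix q assume "q \<in> saturate D1 D2 A"
  then obtain X where X: "X \<subseteq> Pow A" and
    q: "q = (\<Oplus>\<^bsub>D1\<^esub>J\<in>X. \<Otimes>\<^bsub>D1\<^esub>p\<in>J. fst p, \<Otimes>\<^bsub>D2\<^esub>J\<in>X. \<Oplus>\<^bsub>D2\<^esub>p\<in>J. snd p) \<or>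
      q = (\<Otimes>\<^bsub>D1\<^esub>J\<in>X. \<Oplus>\<^bsub>D1\<^esub>p\<in>J. fst p, \<Oplus>\<^bsub>D2\<^esub>J\<in>X. \<Otimes>\<^bsub>D2\<^esub>p\<in>J. snd p)"
    unfolding saturate_def by blast
  have finX: "finite X" using X A finite_subset by (metis finite_Pow_iff)
  have J: "J \<subseteq> A" "fin_rel J" if "J \<in> X" for J
    using that X fin_rel_subset[OF A] by auto
  from q show "ann_le D2 (snd q) (cl A (fst q))"
  proof
    assume q: "q = (\<Oplus>\<^bsub>D1\<^esub>J\<in>X. \<Otimes>\<^bsub>D1\<^esub>p\<in>J. fst p, \<Otimes>\<^bsub>D2\<^esub>J\<in>X. \<Oplus>\<^bsub>D2\<^esub>p\<in>J. snd p)"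
    \<comment> \<open>The product of the first components lies below each of them, so by
      antitonicity every \<open>snd p\<close> is a lower bound of the closure there, and hence so is
      their join.\<close>
    have "ann_le D2 (\<Oplus>\<^bsub>D2\<^esub>p\<in>J. snd p) (cl A (\<Otimes>\<^bsub>D1\<^esub>p\<in>J. fst p))" if "J \<in> X" for J
    proof (rule D2.finsum_least)
      fix p assume p: "p \<in> J"
      then have "ann_le D2 (snd p) (cl A (fst p))"
        using derives_subset[OF A J(1)] that unfolding derives_def by blast
      moreover have "ann_le D1 (\<Otimes>\<^bsub>D1\<^esub>p\<in>J. fst p) (fst p)"
        using p J that components_closed by (intro D1.finprod_lower) auto
      moreover have "fst p \<in> carrier D1" "snd p \<in> carrier D2" using p J[OF that] by auto
      ultimately show "ann_le D2 (snd p) (cl A (\<Otimes>\<^bsub>D1\<^esub>p\<in>J. fst p))"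
        using le_cl_antimono[OF A sums_closed(2)] J(2)[OF that] by simp
    qed (use J that components_closed sums_closed cl_closed[OF A] in auto)
    \<comment> \<open>The inner pairs of sums and products now serve as the family indexed by
      \<open>X\<close>.\<close>
    then show ?thesis
      unfolding q fst_conv snd_conv using J sums_closed
      by (intro finprod_le_cl_finsum[OF A finX]) auto
  next
    assume q: "q = (\<Otimes>\<^bsub>D1\<^esub>J\<in>X. \<Oplus>\<^bsub>D1\<^esub>p\<in>J. fst p, \<Oplus>\<^bsub>D2\<^esub>J\<in>X. \<Otimes>\<^bsub>D2\<^esub>p\<in>J. snd p)"
    let ?m = "\<Otimes>\<^bsub>D1\<^esub>J\<in>X. join_fst J"
    have m: "?m \<in> carrier D1" using J sums_closed by (intro D1.finprod_closed) auto
    have "ann_le D2 (\<Oplus>\<^bsub>D2\<^esub>J\<in>X. prod_snd J) (cl A ?m)"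
    proof (rule D2.finsum_least)
      fix K assume K: "K \<in> X"
      \<comment> \<open>The outer product lies below each factor, which makes \<open>K\<close>
        itself an admissible set at \<open>?m\<close>.\<close>
      have "ann_le D1 ?m (join_fst K)"
        using K J sums_closed finX by (intro D1.finprod_lower) auto
      then show "ann_le D2 (prod_snd K) (cl A ?m)"
        by (rule cl_upper[OF A m J(1)[OF K]])
    qed (use J finX m sums_closed cl_closed[OF A] in auto)
    then show ?thesis unfolding q by simp
  qed
qed

lemma cl_saturate:
  assumes "fin_rel A"
  shows "cl (saturate D1 D2 A) = cl A"
  by (rule cl_eqI[OF saturate_fin[OF assms] assms])
    (simp_all add: assms derives_saturate derives_subset subset_saturate saturate_fin)

section \<open>Reduction preserves the closure\<close>

lemma cl_prune_step:
  assumes R: "fin_rel R" and step: "prune_step D1 D2 R R'"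
  shows "fin_rel R' \<and> cl R' = cl R"
proof -
  obtain p q where pq: "p \<in> R" "q \<in> R" "q \<noteq> p" "ann_le D1 (fst p) (fst q)"
    "ann_le D2 (snd p) (snd q)" and R': "R' = R - {p}"
    using step unfolding prune_step_def by blast
  have fin: "fin_rel R'" using fin_rel_subset[OF R] R' by simp
  have closed: "fst p \<in> carrier D1" "fst q \<in> carrier D1" "snd p \<in> carrier D2" "snd q \<in> carrier D2"
    using pq R by auto
  have self: "ann_le D2 (snd r) (cl R' (fst r))" if "r \<in> R'" for r
    using derives_subset[OF fin] that unfolding derives_def by blast
  \<comment> \<open>The dominating pair \<open>q\<close> survives because it differs from
    \<open>p\<close>. Its second component bounds \<open>snd p\<close>, and antitonicity then moves
    the argument from \<open>fst q\<close> down to \<open>fst p\<close>.\<close>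
  have "ann_le D2 (snd p) (cl R' (fst q))"
    using D2.ann_le_trans[OF closed(3,4) cl_closed[OF fin closed(2)] pq(5)] self[of q] pq R'
    by simp
  then have "ann_le D2 (snd p) (cl R' (fst p))"
    by (rule le_cl_antimono[OF fin closed(1,2) pq(4) closed(3)])
  then have "derives R' R" unfolding derives_def using self R' by blast
  moreover have "derives R R'" using derives_subset[OF R] R' by blast
  ultimately show ?thesis using cl_eqI[OF fin R] fin by simp
qed

lemma cl_prune_steps:
  assumes "(prune_step D1 D2)\<^sup>*\<^sup>* R S" "fin_rel R"
  shows "fin_rel S \<and> cl S = cl R"
  using assms(1)
proof (induction rule: rtranclp_induct)
  case base
  show ?case using assms(2) by blast
next
  case (step T T')
  then show ?case using cl_prune_step[of T T'] by auto
qed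

lemma cl_reduce:
  assumes R: "fin_rel R"
  shows "cl (reduce D1 D2 R) = cl R"
proof -
  define S where "S = (THE S. pruned_to D1 D2 R S)"
  \<comment> \<open>The definite description in \<open>reduce\<close> denotes an actual result of
    pruning, since exactly one exists.\<close>
  have "pruned_to D1 D2 R S"
    unfolding S_def
    by (rule theI'[OF ex1_pruned_to[OF D1.annotation_domain_axioms D2.annotation_domain_axioms]])
      (use R in simp_all)
  then have "(prune_step D1 D2)\<^sup>*\<^sup>* R S" unfolding pruned_to_def by (rule conjunct1)
  from cl_prune_steps[OF this R] have S: "fin_rel S" "cl S = cl R" by simp_all
  define T where "T = S - {p. fst p = \<zero>\<^bsub>D1\<^esub> \<or> snd p = \<zero>\<^bsub>D2\<^esub>}"
  have T: "fin_rel T" using fin_rel_subset[OF S(1)] unfolding T_def by simp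
  have "derives T S"
    unfolding derives_def
  proof
    fix p assume p: "p \<in> S"
    then have closed: "fst p \<in> carrier D1" "snd p \<in> carrier D2" using S by auto
    \<comment> \<open>The discarded pairs are trivially derivable: any closure takes the top value
      at zero, and a zero second component lies below everything.\<close>
    consider "fst p = \<zero>\<^bsub>D1\<^esub>" | "snd p = \<zero>\<^bsub>D2\<^esub>" | "p \<in> T" using p unfolding T_def by blast
    then show "ann_le D2 (snd p) (cl T (fst p))"
    proof cases
      case 1
      then show ?thesis using cl_zero[OF T] closed by simp
    next
      case 2
      then show ?thesis using D2.zero_le cl_closed[OF T] closed by simp
    next
      case 3
      then show ?thesis using derives_subset[OF T] unfolding derives_def by blast
    qed
  qed
  moreover have "derives S T" using derives_subset[OF S(1)] unfolding T_def by simp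
  ultimately have "cl T = cl S" by (rule cl_eqI[OF T S(1)])
  then show ?thesis using S(2) unfolding reduce_def T_def S_def by simp
qed

end

theorem proposition5p3:
  fixes D1 :: "('a, 'm) ring_scheme" and D2 :: "('b, 'n) ring_scheme"
  assumes "annotation_domain D1" and "annotation_domain D2"
    and "mult_is_meet D1"
    and "finite A" and "A \<subseteq> carrier D1 \<times> carrier D2"
  shows "closure_fun D1 D2 A = closure_fun D1 D2 (normalise D1 D2 A)"
proof -
  interpret annotation_domain_pair D1 D2
    using assms(1,2) by (rule annotation_domain_pair.intro)
  show ?thesis
    unfolding normalise_def using assms(4,5) by (simp add: cl_reduce cl_saturate saturate_fin)
qed

end
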